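(* Let $B\in M(n;\mathbb{R})$ and $v,w\in\mathbb{R}^n$. The linear system of second order $\ddot c(t)=Bc(t)$ with initial values $c(0)=v$, $\dot c(0)=w$ has the unique solution $$c(t)=\mathrm{co}_B(t)(v)+\mathrm{si}_B(t)(w),\qquad t\in\mathbb{R}.$$ Moreover, for this solution the one-parameter family of curves $$c_s(t):=\tfrac14\{c(t-s)+2c(t)+c(t+s)\},\qquad s,t\in\mathbb{R},$$ satisfies, for all $s,t\in\mathbb{R}$, $$c_s(t)=A(s)\,c(t),\qquad\text{where } A(s)=\tfrac12\left\{\mathbb{1}+\mathrm{co}_B(s)\right\};$$ that is, $c_s$ is a linear image of $c$ for any $s$.
   Context: $M(n;\mathbb{R})$ is the space of real $n\times n$ matrices and $\mathbb{1}$ the identity matrix. For $B\in M(n;\mathbb{R})$ and $t\in\mathbb{R}$, $\mathrm{co}_B(t):=\sum_{k=0}^\infty\frac{t^{2k}}{(2k)!}B^k$ and $\mathrm{si}_B(t):=\sum_{k=0}^\infty\frac{t^{2k+1}}{(2k+1)!}B^k$. *)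

theory Defs
  imports "HOL-Analysis.Analysis"
begin

text \<open>On \<^typ>\<open>real^'n^'n\<close> the operations \<open>*\<close>, \<open>1\<close> and \<open>^\<close> are componentwise, so matrix powers
  are built from \<open>**\<close> and \<open>mat 1\<close>.\<close>

primrec matpow :: "real^'n^'n \<Rightarrow> nat \<Rightarrow> real^'n^'n" where
  "matpow B 0 = mat 1"
| "matpow B (Suc k) = B ** matpow B k"

definition co :: "real^'n^'n \<Rightarrow> real \<Rightarrow> real^'n^'n" where
  "co B t = (\<Sum>k. (t ^ (2 * k) / fact (2 * k)) *\<^sub>R matpow B k)"

definition si :: "real^'n^'n \<Rightarrow> real \<Rightarrow> real^'n^'n" where
  "si B t = (\<Sum>k. (t ^ (2 * k + 1) / fact (2 * k + 1)) *\<^sub>R matpow B k)"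

definition solves_second_order_ivp ::
    "real^'n^'n \<Rightarrow> real^'n \<Rightarrow> real^'n \<Rightarrow> (real \<Rightarrow> real^'n) \<Rightarrow> bool" where
  "solves_second_order_ivp B v w c \<longleftrightarrow>
     (\<exists>c'. (\<forall>t. (c has_vector_derivative c' t) (at t)) \<and>
           (\<forall>t. (c' has_vector_derivative B *v c t) (at t)) \<and>
           c 0 = v \<and> c' 0 = w)"

definition averaged_curve :: "(real \<Rightarrow> real^'n) \<Rightarrow> real \<Rightarrow> real \<Rightarrow> real^'n" where
  "averaged_curve c s t = (1/4) *\<^sub>R (c (t - s) + 2 *\<^sub>R c t + c (t + s))"

definition averaging_matrix :: "real^'n^'n \<Rightarrow> real \<Rightarrow> real^'n^'n" where
  "averaging_matrix B s = (1/2) *\<^sub>R (mat 1 + co B s)"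

text \<open>Both series converge absolutely, so the values of \<^const>\<open>suminf\<close> above are genuine sums.\<close>

lemma norm_matpow_bound:
  fixes B :: "real^'n^'n"
  obtains M r where "0 \<le> M" "0 \<le> r" "\<And>k. norm (matpow B k) \<le> M * r ^ k"
proof -
  have "bounded_linear ((**) B :: real^'n^'n \<Rightarrow> real^'n^'n)"
    by (rule linear_conv_bounded_linear[THEN iffD1])
       (auto intro!: linearI simp: matrix_add_ldistrib matrix_scalar_ac
             simp flip: scalar_matrix_assoc)
  then obtain r where r: "0 \<le> r" "\<And>X :: real^'n^'n. norm (B ** X) \<le> norm X * r"
    using bounded_linear.nonneg_bounded by blast
  have "norm (matpow B k) \<le> norm (mat 1 :: real^'n^'n) * r ^ k" for k
  proof (induction k)
    case (Suc k)
    have "norm (matpow B (Suc k)) \<le> norm (matpow B k) * r" using r(2) by simp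
    also have "\<dots> \<le> (norm (mat 1 :: real^'n^'n) * r ^ k) * r"
      using Suc r(1) by (rule mult_right_mono)
    finally show ?case by (simp add: mult_ac)
  qed simp
  then show thesis using r(1) that[of "norm (mat 1 :: real^'n^'n)" r] by simp
qed

lemma summable_co_si_aux:
  fixes B :: "real^'n^'n" and e :: nat
  shows "summable (\<lambda>k. norm ((t ^ (2 * k + e) / fact (2 * k + e)) *\<^sub>R matpow B k))"
proof -
  obtain M r where M: "0 \<le> M" "0 \<le> r" "\<And>k. norm (matpow B k) \<le> M * r ^ k"
    using norm_matpow_bound by blast
  have "summable (\<lambda>k. (M * \<bar>t\<bar> ^ e) * (inverse (fact k) * (t\<^sup>2 * r) ^ k))"
    by (intro summable_mult summable_exp)
  then show ?thesis
  proof (rule summable_comparison_test'[where N = 0])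
    fix k :: nat
    have f: "(fact k :: real) \<le> fact (2 * k + e)" by (rule fact_mono) simp
    have "norm ((t ^ (2 * k + e) / fact (2 * k + e)) *\<^sub>R matpow B k)
            = \<bar>t\<bar> ^ (2 * k + e) / fact (2 * k + e) * norm (matpow B k)"
      by (simp add: power_abs)
    also have "\<dots> \<le> \<bar>t\<bar> ^ (2 * k + e) / fact k * (M * r ^ k)"
      using f M by (intro mult_mono divide_left_mono) auto
    also have "\<bar>t\<bar> ^ (2 * k + e) = (t\<^sup>2) ^ k * \<bar>t\<bar> ^ e"
      by (simp add: power_add power_mult)
    also have "(t\<^sup>2) ^ k * \<bar>t\<bar> ^ e / fact k * (M * r ^ k) = (M * \<bar>t\<bar> ^ e) * (inverse (fact k) * (t\<^sup>2 * r) ^ k)"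
      by (simp add: power_mult_distrib field_simps)
    finally show "norm (norm ((t ^ (2 * k + e) / fact (2 * k + e)) *\<^sub>R matpow B k))
       \<le> (M * \<bar>t\<bar> ^ e) * (inverse (fact k) * (t\<^sup>2 * r) ^ k)" by simp
  qed
qed

lemma summable_norm_co:
  "summable (\<lambda>k. norm ((t ^ (2 * k) / fact (2 * k)) *\<^sub>R matpow B k))"
  using summable_co_si_aux[where e = 0 and t = t and B = B] by simp

lemma summable_norm_si:
  "summable (\<lambda>k. norm ((t ^ (2 * k + 1) / fact (2 * k + 1)) *\<^sub>R matpow B k))"
  using summable_co_si_aux[where e = 1 and t = t and B = B] by simp

end

theory Submission
  imports Defs
begin

text \<open>
  Differentiating the two series term by term gives \<open>co' = B si\<close> and \<open>si' = co\<close>, with initial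
  values \<open>co 0 = 1\<close> and \<open>si 0 = 0\<close> (lemmas \<open>co_has_vector_derivative\<close> and
  \<open>si_has_vector_derivative\<close>). Hence the curve \<open>co t v + si t w\<close> solves the initial value problem.

  Uniqueness is obtained by variation of parameters, without a Gronwall estimate: if \<open>c\<close> is any
  solution and \<open>s\<close> is a fixed time, then the curve \<open>t \<mapsto> co (s - t) (c t) + si (s - t) (c' t)\<close> has
  derivative \<open>- B si c + co c' - co c' + si B c = 0\<close>, because \<open>B\<close> commutes with \<open>si\<close>. Comparing its
  values at \<open>t = 0\<close> and \<open>t = s\<close> gives \<open>co s v + si s w = c s\<close>.

  The system is autonomous, so this formula may be used with any time \<open>t\<close> as the initial one:
  \<open>c (t + s) = co s (c t) + si s (c' t)\<close>. As \<open>co\<close> is even and \<open>si\<close> is odd, the velocity terms cancel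
  in \<open>c (t + s) + c (t - s) = 2 co s (c t)\<close>, which is the claim about the averaged curves.
\<close>

section \<open>Term-by-term differentiation\<close>

text \<open>
  A locally uniform summable bound on the derivatives makes the series of derivatives converge
  locally uniformly by the Weierstrass test.
\<close>

lemma has_vector_derivative_suminf:
  fixes f f' :: "nat \<Rightarrow> real \<Rightarrow> 'a::banach"
  assumes deriv: "\<And>n t. (f n has_vector_derivative f' n t) (at t)"
    and bound: "\<And>n t. \<bar>t\<bar> \<le> R \<Longrightarrow> norm (f' n t) \<le> M n" and M: "summable M"
    and summable: "\<And>t. summable (\<lambda>n. f n t)"
    and x: "\<bar>x\<bar> < R"
  shows "((\<lambda>t. \<Sum>n. f n t) has_vector_derivative (\<Sum>n. f' n x)) (at x)"
proof -
  let ?S = "ball (0::real) R"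
  have xS: "x \<in> ?S" using x by simp
  have unif: "uniform_limit ?S (\<lambda>n t. \<Sum>i<n. f' i t) (\<lambda>t. \<Sum>i. f' i t) sequentially"
    by (rule Weierstrass_m_test[OF _ M]) (auto intro: bound)
  have "\<exists>g. \<forall>t\<in>?S. (\<lambda>n. f n t) sums g t \<and>
      (g has_derivative (\<lambda>h. h *\<^sub>R (\<Sum>i. f' i t))) (at t within ?S)"
  proof (rule has_derivative_series[OF _ _ _ xS])
    show "(f n has_derivative (\<lambda>h. h *\<^sub>R f' n t)) (at t within ?S)" for n t
      using has_vector_derivative_at_within[OF deriv] by (simp add: has_vector_derivative_def)
    show "\<forall>\<^sub>F n in sequentially. \<forall>t\<in>?S. \<forall>h.
        norm ((\<Sum>i<n. h *\<^sub>R f' i t) - h *\<^sub>R (\<Sum>i. f' i t)) \<le> e * norm h" if "e > 0" for e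
      using uniform_limitD[OF unif that]
    proof eventually_elim
      case (elim n)
      show ?case
      proof (intro ballI allI)
        fix t h :: real assume "t \<in> ?S"
        then have "norm ((\<Sum>i<n. f' i t) - (\<Sum>i. f' i t)) \<le> e"
          using elim by (auto simp: dist_norm intro: less_imp_le)
        then have "\<bar>h\<bar> * norm ((\<Sum>i<n. f' i t) - (\<Sum>i. f' i t)) \<le> \<bar>h\<bar> * e"
          by (rule mult_left_mono) simp
        then show "norm ((\<Sum>i<n. h *\<^sub>R f' i t) - h *\<^sub>R (\<Sum>i. f' i t)) \<le> e * norm h"
          by (simp flip: scaleR_sum_right scaleR_diff_right add: mult.commute)
      qed
    qed
    show "(\<lambda>n. f n x) sums (\<Sum>n. f n x)"
      using summable by (rule summable_sums)
  qed simp
  then obtain g where g: "\<And>t. t \<in> ?S \<Longrightarrow> (\<lambda>n. f n t) sums g t"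
    "\<And>t. t \<in> ?S \<Longrightarrow> (g has_derivative (\<lambda>h. h *\<^sub>R (\<Sum>i. f' i t))) (at t within ?S)"
    by blast
  have "(g has_vector_derivative (\<Sum>n. f' n x)) (at x)"
    using g(2)[OF xS] at_within_open[OF xS open_ball] by (simp add: has_vector_derivative_def)
  then show ?thesis
    by (rule has_vector_derivative_transform_within_open[OF _ open_ball xS])
       (use g(1) in \<open>auto simp: sums_iff\<close>)
qed

section \<open>The derivatives of the two matrix functions\<close>

text \<open>
  A common extension of \<^const>\<open>co\<close> (case \<open>e = 0\<close>) and \<^const>\<open>si\<close> (case \<open>e = 1\<close>): differentiation
  lowers \<open>e\<close> by one, and no term is lost as long as \<open>e\<close> is positive. The derivative of \<^const>\<open>co\<close>,
  whose constant term does disappear, then comes from the case \<open>e = 2\<close>.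
\<close>

definition shifted_series :: "real^'n^'n \<Rightarrow> nat \<Rightarrow> real \<Rightarrow> real^'n^'n" where
  "shifted_series B e t = (\<Sum>k. (t ^ (2 * k + e) / fact (2 * k + e)) *\<^sub>R matpow B k)"

lemma co_eq_shifted_series: "co B = shifted_series B 0"
  by (simp add: co_def shifted_series_def fun_eq_iff)

lemma si_eq_shifted_series: "si B = shifted_series B 1"
  by (simp add: si_def shifted_series_def fun_eq_iff)

lemmas summable_shifted_series = summable_norm_cancel[OF summable_co_si_aux]

lemma shifted_series_has_vector_derivative:
  "(shifted_series B (Suc e) has_vector_derivative shifted_series B e t) (at t)"
proof -
  define R where "R = \<bar>t\<bar> + 1"
  have term_deriv: "((\<lambda>t. (t ^ (2 * k + Suc e) / fact (2 * k + Suc e)) *\<^sub>R matpow B k)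
      has_vector_derivative (t ^ (2 * k + e) / fact (2 * k + e)) *\<^sub>R matpow B k) (at t)" for k t
  proof -
    have "((\<lambda>t. t ^ Suc (2 * k + e) / fact (Suc (2 * k + e)))
        has_real_derivative real (Suc (2 * k + e)) * t ^ (2 * k + e) / fact (Suc (2 * k + e))) (at t)"
      by (rule DERIV_cdivide) (use DERIV_pow[of "Suc (2 * k + e)" t] in simp)
    moreover have "real (Suc (2 * k + e)) * t ^ (2 * k + e) / fact (Suc (2 * k + e)) =
        t ^ (2 * k + e) / fact (2 * k + e)"
      by (subst fact_Suc) (simp add: divide_simps del: of_nat_Suc)
    ultimately show ?thesis
      using has_vector_derivative_scaleR[OF _ has_vector_derivative_const] by fastforce
  qed
  have "((\<lambda>t. \<Sum>k. (t ^ (2 * k + Suc e) / fact (2 * k + Suc e)) *\<^sub>R matpow B k)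
      has_vector_derivative (\<Sum>k. (t ^ (2 * k + e) / fact (2 * k + e)) *\<^sub>R matpow B k)) (at t)"
  proof (rule has_vector_derivative_suminf[OF term_deriv _ summable_co_si_aux summable_shifted_series])
    show "norm ((t ^ (2 * k + e) / fact (2 * k + e)) *\<^sub>R matpow B k)
        \<le> norm ((R ^ (2 * k + e) / fact (2 * k + e)) *\<^sub>R matpow B k)" if "\<bar>t\<bar> \<le> R" for k t
    proof -
      have "\<bar>t\<bar> ^ (2 * k + e) \<le> \<bar>R\<bar> ^ (2 * k + e)"
        using that by (intro power_mono) auto
      then show ?thesis
        by (auto simp: power_abs intro!: mult_right_mono divide_right_mono)
    qed
    show "\<bar>t\<bar> < R" by (simp add: R_def)
  qed
  then show ?thesis
    by (simp add: shifted_series_def[abs_def])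
qed

lemma bounded_linear_matrix_mult_left: "bounded_linear (\<lambda>X. (A::real^'n^'m) ** (X::real^'p^'n))"
  by (rule linear_conv_bounded_linear[THEN iffD1])
     (auto intro!: linearI simp: matrix_add_ldistrib matrix_scalar_ac simp flip: scalar_matrix_assoc)

lemma bounded_linear_matrix_mult_right: "bounded_linear (\<lambda>X. (X::real^'n^'m) ** (A::real^'p^'n))"
  by (rule linear_conv_bounded_linear[THEN iffD1])
     (auto intro!: linearI simp: matrix_matrix_mult_def vec_eq_iff sum.distrib distrib_right
        sum_distrib_left mult.assoc)

lemma bounded_bilinear_matrix_vector_mult:
  "bounded_bilinear (\<lambda>(A::real^'n^'m) x. A *v x)"
  by (rule bilinear_conv_bounded_bilinear[THEN iffD1])
     (auto simp: bilinear_def matrix_vector_mult_add_rdistrib matrix_vector_right_distrib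
        matrix_vector_mult_scaleR scaleR_matrix_vector_assoc intro!: linearI)

lemma co_split_head: "co B t = mat 1 + B ** shifted_series B 2 t"
proof -
  have "summable (\<lambda>k. (t ^ (2 * k) / fact (2 * k)) *\<^sub>R matpow B k)"
    by (rule summable_norm_cancel[OF summable_norm_co])
  from suminf_split_head[OF this]
  have "co B t = mat 1 + (\<Sum>k. (t ^ (2 * Suc k) / fact (2 * Suc k)) *\<^sub>R matpow B (Suc k))"
    by (simp add: co_def)
  also have "(\<Sum>k. (t ^ (2 * Suc k) / fact (2 * Suc k)) *\<^sub>R matpow B (Suc k)) =
      (\<Sum>k. B ** ((t ^ (2 * k + 2) / fact (2 * k + 2)) *\<^sub>R matpow B k))"
    by (simp add: matrix_scalar_ac scalar_matrix_assoc)
  also have "\<dots> = B ** shifted_series B 2 t"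
    unfolding shifted_series_def
    by (rule bounded_linear.suminf[OF bounded_linear_matrix_mult_left summable_shifted_series, symmetric])
  finally show ?thesis .
qed

lemma co_has_vector_derivative: "(co B has_vector_derivative B ** si B t) (at t)"
proof -
  have "(shifted_series B 2 has_vector_derivative si B t) (at t)"
    using shifted_series_has_vector_derivative[of B 1 t]
    by (simp add: si_eq_shifted_series numeral_2_eq_2)
  then have "((\<lambda>t. B ** shifted_series B 2 t) has_vector_derivative B ** si B t) (at t)"
    by (rule bounded_linear.has_vector_derivative[OF bounded_linear_matrix_mult_left])
  then have "((\<lambda>t. mat 1 + B ** shifted_series B 2 t) has_vector_derivative B ** si B t) (at t)"
    using has_vector_derivative_add[OF has_vector_derivative_const] by fastforce
  then show ?thesis
    by (simp flip: co_split_head)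
qed

lemma si_has_vector_derivative: "(si B has_vector_derivative co B t) (at t)"
  using shifted_series_has_vector_derivative[of B 0 t]
  by (simp add: si_eq_shifted_series co_eq_shifted_series)

lemma shifted_series_0: "shifted_series B e 0 = (if e = 0 then mat 1 else 0)"
proof -
  have "shifted_series B e 0 = (\<Sum>k\<in>{0}. (0 ^ (2 * k + e) / fact (2 * k + e)) *\<^sub>R matpow B k)"
    unfolding shifted_series_def by (rule suminf_finite) auto
  then show ?thesis by simp
qed

lemma co_0: "co B 0 = mat 1"
  by (simp add: co_eq_shifted_series shifted_series_0)

lemma si_0: "si B 0 = 0"
  by (simp add: si_eq_shifted_series shifted_series_0)

lemma co_minus: "co B (- t) = co B t"
  by (simp add: co_def)

lemma si_minus: "si B (- t) = - si B t"
  using summable_norm_cancel[OF summable_norm_si, of t B]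
  by (simp add: si_def suminf_minus)

lemma matpow_commute: "B ** matpow B k = matpow B k ** B"
  by (induction k) (simp, metis matpow.simps(2) matrix_mul_assoc)

lemma si_commute: "B ** si B t = si B t ** B"
proof -
  let ?a = "\<lambda>k. (t ^ (2 * k + 1) / fact (2 * k + 1)) *\<^sub>R matpow B k"
  have summable: "summable ?a"
    by (rule summable_norm_cancel[OF summable_norm_si])
  have "B ** si B t = (\<Sum>k. B ** ?a k)"
    unfolding si_def by (rule bounded_linear.suminf[OF bounded_linear_matrix_mult_left summable])
  also have "\<dots> = (\<Sum>k. ?a k ** B)"
    by (simp only: matrix_scalar_ac matpow_commute flip: scalar_matrix_assoc)
  also have "\<dots> = si B t ** B"
    unfolding si_def
    by (rule bounded_linear.suminf[OF bounded_linear_matrix_mult_right summable, symmetric])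
  finally show ?thesis .
qed

section \<open>Existence, uniqueness and averaging\<close>

lemma co_si_solves:
  "solves_second_order_ivp B v w (\<lambda>t. co B t *v v + si B t *v w)"
proof -
  note deriv = bounded_linear.has_vector_derivative
    [OF bounded_bilinear.bounded_linear_left[OF bounded_bilinear_matrix_vector_mult]]
  have "((\<lambda>t. co B t *v v + si B t *v w) has_vector_derivative
      (B ** si B t) *v v + co B t *v w) (at t)" for t
    by (intro has_vector_derivative_add deriv co_has_vector_derivative si_has_vector_derivative)
  moreover have "((\<lambda>t. (B ** si B t) *v v + co B t *v w) has_vector_derivative
      B *v (co B t *v v + si B t *v w)) (at t)" for t
  proof -
    have "((\<lambda>t. (B ** si B t) *v v + co B t *v w) has_vector_derivative
        (B ** co B t) *v v + (B ** si B t) *v w) (at t)"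
      by (intro has_vector_derivative_add deriv co_has_vector_derivative si_has_vector_derivative
            bounded_linear.has_vector_derivative[OF bounded_linear_matrix_mult_left])
    then show ?thesis
      by (simp add: matrix_vector_right_distrib matrix_vector_mul_assoc)
  qed
  ultimately show ?thesis
    unfolding solves_second_order_ivp_def
    by (intro exI[of _ "\<lambda>t. (B ** si B t) *v v + co B t *v w"]) (auto simp: co_0 si_0)
qed

text \<open>
  Variation of parameters: propagating the state of the solution at time \<open>t\<close> up to a fixed time \<open>s\<close>
  gives a vector that does not depend on \<open>t\<close>.
\<close>

lemma second_order_solution_formula:
  fixes B :: "real^'n^'n"
  assumes c: "\<And>t. (c has_vector_derivative c' t) (at t)"
    and c': "\<And>t. (c' has_vector_derivative B *v c t) (at t)"
  shows "c s = co B s *v c 0 + si B s *v c' 0"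
proof -
  define F where "F t = co B (s - t) *v c t + si B (s - t) *v c' t" for t
  have reflect: "((\<lambda>t. f (s - t)) has_vector_derivative - f') (at t)"
    if "(f has_vector_derivative f') (at (s - t))" for f :: "real \<Rightarrow> real^'n^'n" and f' t
  proof -
    have "((\<lambda>t. s - t) has_vector_derivative - 1) (at t)"
      by (auto intro!: derivative_eq_intros)
    from vector_diff_chain_at[OF this that] show ?thesis
      by (simp add: o_def)
  qed
  have "(F has_vector_derivative 0) (at t)" for t
  proof -
    have "(F has_vector_derivative
        (co B (s - t) *v c' t + (- (B ** si B (s - t))) *v c t) +
        (si B (s - t) *v (B *v c t) + (- co B (s - t)) *v c' t)) (at t)"
      unfolding F_def
      by (intro has_vector_derivative_add c c' reflect co_has_vector_derivative si_has_vector_derivative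
            bounded_bilinear.has_vector_derivative[OF bounded_bilinear_matrix_vector_mult])
    then show ?thesis
      by (simp add: si_commute matrix_vector_mul_assoc
            bounded_bilinear.minus_left[OF bounded_bilinear_matrix_vector_mult])
  qed
  then have "F 0 = F s"
    by (intro has_derivative_zero_unique[of UNIV F 0 s]) (auto simp: has_vector_derivative_def)
  then show ?thesis
    by (simp add: F_def co_0 si_0)
qed

text \<open>
  Adding the solution formulas for the times \<open>s\<close> and \<open>- s\<close>, with \<open>t\<close> as the initial time, cancels
  the velocity at \<open>t\<close>.
\<close>

lemma second_order_solution_symmetric_sum:
  fixes B :: "real^'n^'n"
  assumes c: "\<And>t. (c has_vector_derivative c' t) (at t)"
    and c': "\<And>t. (c' has_vector_derivative B *v c t) (at t)"
  shows "c (t - s) + c (t + s) = 2 *\<^sub>R (co B s *v c t)"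
proof -
  have shift: "((\<lambda>r. f (t + r)) has_vector_derivative f') (at r)"
    if "(f has_vector_derivative f') (at (t + r))" for f :: "real \<Rightarrow> real^'n" and f' r
  proof -
    have "((\<lambda>r. t + r) has_vector_derivative 1) (at r)"
      by (auto intro!: derivative_eq_intros)
    from vector_diff_chain_at[OF this that] show ?thesis
      by (simp add: o_def)
  qed
  have flow: "c (t + r) = co B r *v c t + si B r *v c' t" for r
    using second_order_solution_formula[OF shift[OF c] shift[OF c'], of r] by simp
  show ?thesis
    using flow[of s] flow[of "- s"]
    by (simp add: co_minus si_minus scaleR_2
          bounded_bilinear.minus_left[OF bounded_bilinear_matrix_vector_mult])
qed

theorem proposition2:
  fixes B :: "real^'n^'n" and v w :: "real^'n"
  shows "(\<forall>c. solves_second_order_ivp B v w c \<longleftrightarrow> c = (\<lambda>t. co B t *v v + si B t *v w)) \<and>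
         (\<forall>c. solves_second_order_ivp B v w c \<longrightarrow>
            (\<forall>s t. averaged_curve c s t = averaging_matrix B s *v c t))"
proof (intro conjI allI impI iffI)
  fix c assume "solves_second_order_ivp B v w c"
  then show "c = (\<lambda>t. co B t *v v + si B t *v w)"
    unfolding solves_second_order_ivp_def using second_order_solution_formula by blast
next
  fix c :: "real \<Rightarrow> real^'n" assume "c = (\<lambda>t. co B t *v v + si B t *v w)"
  then show "solves_second_order_ivp B v w c"
    by (simp add: co_si_solves)
next
  fix c s t assume "solves_second_order_ivp B v w c"
  then have "c (t - s) + c (t + s) = 2 *\<^sub>R (co B s *v c t)"
    unfolding solves_second_order_ivp_def using second_order_solution_symmetric_sum by blast
  then have "averaged_curve c s t = (1/4) *\<^sub>R (2 *\<^sub>R c t + 2 *\<^sub>R (co B s *v c t))"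
    unfolding averaged_curve_def by (metis add.commute add.assoc)
  also have "\<dots> = averaging_matrix B s *v c t"
    by (simp add: averaging_matrix_def matrix_vector_mult_add_rdistrib scaleR_right_distrib
          flip: scaleR_matrix_vector_assoc)
  finally show "averaged_curve c s t = averaging_matrix B s *v c t" .
qed

end
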